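(* For each $d \ge 1$, $N \ge 1$ and $\beta > 0$, \[ Z^N_\beta = \mathrm{perm}(A^N_\beta) = 2^{-N^d} \, \mathbb{E}\left[ \prod_{x \in \mathcal{T}^N_\beta} (X_x^2 + Y_x^2) \right] \] and \[ D^N_\beta = - \frac{\partial}{\partial \beta} \left( \frac{1}{N^d} \log Z^N_\beta \right) = - \frac{\partial}{\partial \beta} \left( \frac{1}{N^d} \log \mathbb{E}\left[ \prod_{x \in \mathcal{T}^N_\beta} (X_x^2 + Y_x^2) \right] \right), \] where $X$ and $Y$ are independent copies of the centred Gaussian field $\Psi$.
   Context: Fix a dimension $d \ge 1$ and let $|\cdot|$ be the Euclidean norm on $\mathbb{R}^d$. For $N \ge 1$ let $\mathcal{T}^N = \{1,\dots,N\}^d \subset \mathbb{Z}^d$ and let $\pi^N$ be the set of all bijections $\pi : \mathcal{T}^N \to \mathcal{T}^N$. Let $H^N(\pi) = \sum_{x \in \mathcal{T}^N} |x - \pi(x)|$. For $\beta \ge 0$ let $P^N_\beta(\pi) = \frac{1}{Z^N_\beta} e^{-\beta H^N(\pi)}$ with partition function $Z^N_\beta = \sum_{\pi \in \pi^N} e^{-\beta H^N(\pi)}$. The mean displacement per site is $D^N_\beta = \frac{1}{N^d} E[H^N(\pi)]$, where $E$ is expectation under $P^N_\beta$. $A^N_\beta$ is the $N^d \times N^d$ symmetric matrix indexed by $\mathcal{T}^N$ with entries $(A^N_\beta)_{x,y} = e^{-\beta|x-y|}$, and the permanent of an $n \times n$ matrix $A$ is $\mathrm{perm}(A) = \sum_\pi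 \prod_{i=1}^n A_{i,\pi(i)}$, the sum being over all permutations of $\{1,\dots,n\}$. $\Psi$ is the stationary, almost surely continuous, centred Gaussian field on $\mathbb{R}^d$ with covariance $\mathbb{E}[\Psi(s)\Psi(t)] = e^{-|s-t|}$, and $\mathcal{T}^N_\beta = \beta \{0,\dots,N-1\}^d \subset \beta\mathbb{Z}^d$; $X_x$ denotes the value of $X$ at the point $x$. *)

theory Defs
  imports "HOL-Probability.Probability" "HOL-Combinatorics.Permutations"
begin

text \<open>The box \<open>\<T>\<^sup>N\<close> is a set of integer points of the Euclidean space \<open>\<real>\<^sup>d\<close>, where
  \<open>d = CARD('d)\<close>.  Constants whose other arguments do not mention \<open>'d\<close> take it as \<open>TYPE('d)\<close>.\<close>

definition box_lattice :: "nat \<Rightarrow> (real^'d::finite) set" where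
  "box_lattice N = {x. \<forall>i. \<exists>k\<in>{1..N}. x $ i = real k}"

text \<open>A bijection of the box onto itself is represented by its extension by the identity.\<close>

definition box_perms :: "nat \<Rightarrow> (real^'d::finite \<Rightarrow> real^'d) set" where
  "box_perms N = {p. p permutes box_lattice N}"

definition hamiltonian :: "nat \<Rightarrow> (real^'d::finite \<Rightarrow> real^'d) \<Rightarrow> real" where
  "hamiltonian N p = (\<Sum>x\<in>box_lattice N. norm (x - p x))"

definition partition_function :: "'d::finite itself \<Rightarrow> nat \<Rightarrow> real \<Rightarrow> real" where
  "partition_function TYPE('d) N \<beta> =
     (\<Sum>p\<in>(box_perms N :: (real^'d \<Rightarrow> real^'d) set). exp (- \<beta> * hamiltonian N p))"

definition gibbs_measure :: "nat \<Rightarrow> real \<Rightarrow> (real^'d::finite \<Rightarrow> real^'d) measure" where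
  "gibbs_measure N \<beta> = point_measure (box_perms N)
     (\<lambda>p. ennreal (1 / partition_function TYPE('d) N \<beta> * exp (- \<beta> * hamiltonian N p)))"

definition mean_displacement :: "'d::finite itself \<Rightarrow> nat \<Rightarrow> real \<Rightarrow> real" where
  "mean_displacement TYPE('d) N \<beta> =
     1 / real (N ^ CARD('d)) *
       integral\<^sup>L (gibbs_measure N \<beta> :: (real^'d \<Rightarrow> real^'d) measure) (hamiltonian N)"

text \<open>The permanent of a square matrix whose rows and columns are indexed by the finite set \<open>I\<close>;
  entries outside \<open>I \<times> I\<close> play no role.\<close>

definition permanent :: "'i set \<Rightarrow> ('i \<Rightarrow> 'i \<Rightarrow> real) \<Rightarrow> real" where
  "permanent I A = (\<Sum>p | p permutes I. \<Prod>i\<in>I. A i (p i))"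

definition distance_matrix :: "real \<Rightarrow> real^'d::finite \<Rightarrow> real^'d \<Rightarrow> real" where
  "distance_matrix \<beta> x y = exp (- \<beta> * norm (x - y))"

definition scaled_lattice :: "nat \<Rightarrow> real \<Rightarrow> (real^'d::finite) set" where
  "scaled_lattice N \<beta> = (\<lambda>x. \<beta> *\<^sub>R x) ` {x. \<forall>i. \<exists>k\<in>{0..<N}. x $ i = real k}"

text \<open>Constants count as degenerate Gaussian random variables; this is needed because the linear
  combinations in the definition of a Gaussian field below may vanish.\<close>

definition gaussian_rv :: "'w measure \<Rightarrow> ('w \<Rightarrow> real) \<Rightarrow> bool" where
  "gaussian_rv M Z \<longleftrightarrow> Z \<in> borel_measurable M \<and>
     (\<exists>\<mu> \<sigma>. \<sigma> > 0 \<and> distributed M lborel Z (\<lambda>x. ennreal (normal_density \<mu> \<sigma> x))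
           \<or> \<sigma> = 0 \<and> (AE \<omega> in M. Z \<omega> = \<mu>))"

definition gaussian_field :: "'w measure \<Rightarrow> ('t \<Rightarrow> 'w \<Rightarrow> real) \<Rightarrow> bool" where
  "gaussian_field M X \<longleftrightarrow> prob_space M \<and>
     (\<forall>F a. finite F \<longrightarrow> gaussian_rv M (\<lambda>\<omega>. \<Sum>t\<in>F. a t * X t \<omega>))"

definition stationary_field :: "'w measure \<Rightarrow> ('t::ab_group_add \<Rightarrow> 'w \<Rightarrow> real) \<Rightarrow> bool" where
  "stationary_field M X \<longleftrightarrow>
     (\<forall>h. distr M (PiM UNIV (\<lambda>_. borel)) (\<lambda>\<omega> t. X (t + h) \<omega>) =
          distr M (PiM UNIV (\<lambda>_. borel)) (\<lambda>\<omega> t. X t \<omega>))"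

text \<open>\<open>exp_gaussian_field M X\<close>: on the probability space \<open>M\<close>, the field \<open>X\<close> is a copy of \<open>\<Psi>\<close>.
  A centred Gaussian field is determined in law by its covariance.\<close>

definition exp_gaussian_field :: "'w measure \<Rightarrow> (real^'d::finite \<Rightarrow> 'w \<Rightarrow> real) \<Rightarrow> bool" where
  "exp_gaussian_field M X \<longleftrightarrow>
     gaussian_field M X \<and>
     stationary_field M X \<and>
     (AE \<omega> in M. continuous_on UNIV (\<lambda>t. X t \<omega>)) \<and>
     (\<forall>t. integral\<^sup>L M (X t) = 0) \<and>
     (\<forall>s t. integral\<^sup>L M (\<lambda>\<omega>. X s \<omega> * X t \<omega>) = exp (- norm (s - t)))"

definition independent_fields ::
    "'w measure \<Rightarrow> ('t \<Rightarrow> 'w \<Rightarrow> real) \<Rightarrow> ('t \<Rightarrow> 'w \<Rightarrow> real) \<Rightarrow> bool" where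
  "independent_fields M X Y \<longleftrightarrow>
     prob_space.indep_var M (PiM UNIV (\<lambda>_. borel)) (\<lambda>\<omega> t. X t \<omega>)
                            (PiM UNIV (\<lambda>_. borel)) (\<lambda>\<omega> t. Y t \<omega>)"

definition field_moment ::
    "'w measure \<Rightarrow> (real^'d::finite \<Rightarrow> 'w \<Rightarrow> real) \<Rightarrow> (real^'d \<Rightarrow> 'w \<Rightarrow> real) \<Rightarrow> nat \<Rightarrow> real \<Rightarrow> real" where
  "field_moment M X Y N \<beta> =
     integral\<^sup>L M (\<lambda>\<omega>. \<Prod>x\<in>scaled_lattice N \<beta>. (X x \<omega>)\<^sup>2 + (Y x \<omega>)\<^sup>2)"

end

theory Submission
  imports Defs
begin

text \<open>
  Write \<open>Z = X + \<i> Y\<close>, so that \<open>X\<^sub>t\<^sup>2 + Y\<^sub>t\<^sup>2\<close> is \<open>Z\<^sub>t\<close> times its conjugate.  For sets of points \<open>A\<close> and \<open>B\<close>,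
  the sum of \<open>Z\<close> over \<open>A\<close> plus the sum of the conjugate of \<open>Z\<close> over \<open>B\<close> is \<open>S + \<i> T\<close> with independent
  centred Gaussians \<open>S = X(A) + X(B)\<close> and \<open>T = Y(A) - Y(B)\<close>.  Its moment of order \<open>2m\<close> is
  \<open>(2m)! / (2\<^sup>m m!)\<close> times the \<open>m\<close>-th power of \<open>Var S - Var T\<close>, and this difference is four times the
  sum of the covariances over \<open>A \<times> B\<close>.  Polarization in \<open>(A, B)\<close> recovers the product of all the \<open>Z\<^sub>t\<close> and
  their conjugates on the side of the moments; on the side of the covariances, polarization in \<open>A\<close>
  followed by Ryser's formula in \<open>B\<close> produces the permanent.  The displacement is then the logarithmic
  derivative of the partition function.
\<close>

section \<open>Permanents: Ryser's formula, polarization, relabelling\<close>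

text \<open>Expanding the product of row sums over \<open>T\<close> gives a sum over all functions
  from \<open>S\<close> to \<open>T\<close>. Grouped by their image, these make Moebius inversion on
  subsets isolate the surjections of \<open>S\<close> onto itself, which are the permutations since
  \<open>S\<close> is finite.\<close>

lemma ryser_formula:
  fixes K :: "'i \<Rightarrow> 'i \<Rightarrow> 'b::comm_ring_1"
  assumes "finite S"
  shows "(\<Sum>p | p permutes S. \<Prod>i\<in>S. K i (p i)) =
    (\<Sum>T\<in>Pow S. (- 1) ^ (card S - card T) * (\<Prod>i\<in>S. \<Sum>j\<in>T. K i j))"
proof -
  define surjs :: "'i set \<Rightarrow> ('i \<Rightarrow> 'i) set"
    where "surjs T = {f \<in> S \<rightarrow>\<^sub>E T. f ` S = T}" for T
  have product: "(\<Prod>i\<in>S. \<Sum>j\<in>T. K i j) = (\<Sum>R\<in>Pow T. \<Sum>f\<in>surjs R. \<Prod>i\<in>S. K i (f i))"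
    if "finite T" for T
  proof -
    have "(\<Prod>i\<in>S. \<Sum>j\<in>T. K i j) = (\<Sum>f\<in>S \<rightarrow>\<^sub>E T. \<Prod>i\<in>S. K i (f i))"
      using \<open>finite S\<close> that by (intro prod_sum_PiE) auto
    also have "S \<rightarrow>\<^sub>E T = (\<Union>R\<in>Pow T. surjs R)"
    proof (intro equalityI subsetI)
      fix f assume "f \<in> S \<rightarrow>\<^sub>E T"
      then show "f \<in> (\<Union>R\<in>Pow T. surjs R)"
        by (intro UN_I[of "f ` S"]) (auto simp: surjs_def PiE_iff)
    next
      fix f assume "f \<in> (\<Union>R\<in>Pow T. surjs R)"
      then show "f \<in> S \<rightarrow>\<^sub>E T"
        by (auto simp: surjs_def PiE_iff)
    qed
    also have "(\<Sum>f\<in>\<dots>. \<Prod>i\<in>S. K i (f i)) = (\<Sum>R\<in>Pow T. \<Sum>f\<in>surjs R. \<Prod>i\<in>S. K i (f i))"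
    proof (rule sum.UNION_disjoint)
      have "finite (S \<rightarrow>\<^sub>E R)" if "R \<in> Pow T" for R
        using \<open>finite S\<close> \<open>finite T\<close> that by (auto intro!: finite_PiE dest: finite_subset)
      then show "\<forall>R\<in>Pow T. finite (surjs R)"
        by (auto simp: surjs_def)
    qed (use that in \<open>auto simp: surjs_def\<close>)
    finally show ?thesis .
  qed
  have "(\<Sum>p | p permutes S. \<Prod>i\<in>S. K i (p i)) = (\<Sum>f\<in>surjs S. \<Prod>i\<in>S. K i (f i))"
  \<comment> \<open>Permutations are the identity outside \<open>S\<close>, members of
    \<open>surjs S\<close> are \<open>undefined\<close> there; the two witnesses only translate
    between these conventions.\<close>
  proof (rule sum.reindex_bij_witness[where i = "\<lambda>f x. if x \<in> S then f x else x"
        and j = "\<lambda>p. restrict p S"])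
    fix f assume f: "f \<in> surjs S"
    then show "restrict (\<lambda>x. if x \<in> S then f x else x) S = f"
      by (auto simp: surjs_def PiE_iff extensional_def)
    have "inj_on f S"
      using f \<open>finite S\<close> by (intro eq_card_imp_inj_on) (auto simp: surjs_def)
    then have "bij_betw f S S"
      using f by (simp add: bij_betw_def surjs_def)
    then have "bij_betw (\<lambda>x. if x \<in> S then f x else x) S S"
      by (rule bij_betw_cong[THEN iffD1, rotated]) auto
    then show "(\<lambda>x. if x \<in> S then f x else x) \<in> {p. p permutes S}"
      by (auto intro: bij_imp_permutes)
  next
    fix p assume p: "p \<in> {p. p permutes S}"
    then show "(\<lambda>x. if x \<in> S then restrict p S x else x) = p"
      by (auto simp: fun_eq_iff permutes_not_in)
    show "restrict p S \<in> surjs S"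
      using p by (auto simp: surjs_def permutes_in_image permutes_image)
  qed auto
  also have "\<dots> = (\<Sum>T\<in>Pow S. (- 1) ^ (card S - card T) * (\<Prod>i\<in>S. \<Sum>j\<in>T. K i j))"
    using product \<open>finite S\<close> by (rule inclusion_exclusion_mobius)
  finally show ?thesis .
qed

text \<open>The ring is kept general because the identity serves twice: for complex random variables
  and for real sums of covariances.\<close>

lemma polarization:
  fixes x :: "'i \<Rightarrow> 'b::{comm_ring_1, semiring_char_0}"
  assumes "finite S"
  shows "fact (card S) * prod x S =
    (\<Sum>T\<in>Pow S. (- 1) ^ (card S - card T) * (\<Sum>j\<in>T. x j) ^ card S)"
proof -
  \<comment> \<open>Ryser's formula for the matrix all of whose rows are \<open>x\<close>\<close>
  have "(\<Prod>i\<in>S. x (p i)) = prod x S" if "p permutes S" for p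
    by (rule prod.reindex_bij_betw[OF permutes_imp_bij[OF that]])
  then have "fact (card S) * prod x S = (\<Sum>p | p permutes S. \<Prod>i\<in>S. x (p i))"
    by (simp add: card_permutations[OF refl assms])
  also have "\<dots> = (\<Sum>T\<in>Pow S. (- 1) ^ (card S - card T) * (\<Sum>j\<in>T. x j) ^ card S)"
    by (simp add: ryser_formula[OF assms, of "\<lambda>_. x"])
  finally show ?thesis .
qed

text \<open>Conjugation by \<open>h\<close> carries the permutations of \<open>I\<close> to those of
  \<open>J\<close>, so relabelling rows and columns simultaneously preserves the permanent.\<close>

lemma permanent_reindex:
  assumes h: "bij_betw h I J" and eq: "\<And>x y. x \<in> I \<Longrightarrow> y \<in> I \<Longrightarrow> B (h x) (h y) = A x y"
  shows "permanent J B = permanent I A"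
  unfolding permanent_def
proof (subst sum.reindex_bij_betw[OF bij_betw_permutations[OF h], symmetric], rule sum.cong)
  fix p assume p: "p \<in> {p. p permutes I}"
  have "(\<Prod>i\<in>J. B i (if i \<in> J then h (p (inv_into I h i)) else i)) =
      (\<Prod>i\<in>I. B (h i) (if h i \<in> J then h (p (inv_into I h (h i))) else h i))"
    by (rule prod.reindex_bij_betw[OF h, symmetric])
  also have "\<dots> = (\<Prod>i\<in>I. A i (p i))"
  proof (rule prod.cong)
    fix i assume "i \<in> I"
    then show "B (h i) (if h i \<in> J then h (p (inv_into I h (h i))) else h i) = A i (p i)"
      using p h eq by (auto simp: bij_betw_def permutes_in_image)
  qed simp
  finally show "(\<Prod>i\<in>J. B i (if i \<in> J then h (p (inv_into I h i)) else i)) = (\<Prod>i\<in>I. A i (p i))" .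
qed simp

lemma sum_atMost_double:
  fixes f :: "nat \<Rightarrow> 'b::comm_monoid_add"
  assumes "\<And>k. odd k \<Longrightarrow> f k = 0"
  shows "(\<Sum>k\<le>2 * m. f k) = (\<Sum>k\<le>m. f (2 * k))"
  by (induction m) (use assms in auto)

section \<open>Moments of Gaussian variables and fields\<close>

context prob_space
begin

text \<open>Writing the even moments through the second moment, not through \<open>\<sigma>\<close>,
  covers the degenerate case as well: a centred constant is 0, and the formula then rests on
  \<open>0 ^ 0 = 1\<close>.\<close>

lemma centred_gaussian_moments:
  assumes "gaussian_rv M Z" and "expectation Z = 0"
  shows integrable_gaussian_power: "integrable M (\<lambda>\<omega>. Z \<omega> ^ n)"
    and expectation_gaussian_power_even:
      "expectation (\<lambda>\<omega>. Z \<omega> ^ (2 * k)) = fact (2 * k) / (2 ^ k * fact k) * expectation (\<lambda>\<omega>. (Z \<omega>)\<^sup>2) ^ k"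
    and expectation_gaussian_power_odd: "odd n \<Longrightarrow> expectation (\<lambda>\<omega>. Z \<omega> ^ n) = 0"
proof -
  have Z [measurable]: "Z \<in> borel_measurable M"
    using assms(1) by (simp add: gaussian_rv_def)
  from assms(1) consider \<mu> \<sigma> where "\<sigma> > 0" "distributed M lborel Z (\<lambda>x. ennreal (normal_density \<mu> \<sigma> x))"
    | \<mu> where "AE \<omega> in M. Z \<omega> = \<mu>"
    unfolding gaussian_rv_def by blast
  then have "integrable M (\<lambda>\<omega>. Z \<omega> ^ n) \<and>
    expectation (\<lambda>\<omega>. Z \<omega> ^ (2 * k)) = fact (2 * k) / (2 ^ k * fact k) * expectation (\<lambda>\<omega>. (Z \<omega>)\<^sup>2) ^ k \<and>
    (odd n \<longrightarrow> expectation (\<lambda>\<omega>. Z \<omega> ^ n) = 0)"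
  proof cases
    case (1 \<mu> \<sigma>)
    have "\<mu> = 0"
      using normal_distributed_expectation[OF 1] assms(2) by simp
    note D = 1(2)[unfolded this]
    have int: "integrable M (\<lambda>\<omega>. Z \<omega> ^ n)"
      using distributed_integrable[OF D, of "\<lambda>x. x ^ n"] integrable_normal_moment[OF 1(1), of 0 n]
      by simp
    have E: "expectation (\<lambda>\<omega>. Z \<omega> ^ n) = (LBINT x. normal_density 0 \<sigma> x * x ^ n)" for n
      using distributed_integral[OF D, of "\<lambda>x. x ^ n"] by simp
    have even: "expectation (\<lambda>\<omega>. Z \<omega> ^ (2 * k)) = fact (2 * k) / (2 ^ k * fact k) * (\<sigma>\<^sup>2) ^ k" for k
      using integral_normal_moment_even[OF 1(1), of 0 k] by (simp add: E field_simps)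
    have "expectation (\<lambda>\<omega>. (Z \<omega>)\<^sup>2) = \<sigma>\<^sup>2"
      using even[of 1] by simp
    moreover have "odd n \<Longrightarrow> expectation (\<lambda>\<omega>. Z \<omega> ^ n) = 0"
      using integral_normal_moment_odd[OF 1(1), of 0] by (auto simp: E elim!: oddE)
    ultimately show ?thesis
      using int even by simp
  next
    case (2 \<mu>)
    then have E: "expectation (\<lambda>\<omega>. Z \<omega> ^ n) = \<mu> ^ n" for n
      by (subst integral_cong_AE[where g = "\<lambda>_. \<mu> ^ n"]) (auto simp: prob_space)
    have "\<mu> = 0"
      using E[of 1] assms(2) by simp
    moreover have "integrable M (\<lambda>\<omega>. Z \<omega> ^ n)"
      using 2 by (subst integrable_cong_AE[where g = "\<lambda>_. \<mu> ^ n"]) auto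
    ultimately show ?thesis
      by (auto simp: E power_0_left)
  qed
  then show "integrable M (\<lambda>\<omega>. Z \<omega> ^ n)"
    "expectation (\<lambda>\<omega>. Z \<omega> ^ (2 * k)) = fact (2 * k) / (2 ^ k * fact k) * expectation (\<lambda>\<omega>. (Z \<omega>)\<^sup>2) ^ k"
    "odd n \<Longrightarrow> expectation (\<lambda>\<omega>. Z \<omega> ^ n) = 0"
    by auto
qed

text \<open>\<open>S + \<i> T\<close> has the even moments of a centred Gaussian whose variance is
  formally \<open>Var S - Var T\<close>, possibly negative. Independence factors each term of the
  binomial expansion, and the surviving terms recombine into the expansion of the m-th power of that
  difference.\<close>

lemma expectation_complex_gaussian_power:
  assumes S: "gaussian_rv M S" "expectation S = 0" and T: "gaussian_rv M T" "expectation T = 0"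
    and indep: "indep_var borel S borel T"
  shows "has_bochner_integral M (\<lambda>\<omega>. (complex_of_real (S \<omega>) + \<i> * complex_of_real (T \<omega>)) ^ (2 * m))
    (complex_of_real (fact (2 * m) / (2 ^ m * fact m) *
      (expectation (\<lambda>\<omega>. (S \<omega>)\<^sup>2) - expectation (\<lambda>\<omega>. (T \<omega>)\<^sup>2)) ^ m))"
proof -
  define s t where "s = expectation (\<lambda>\<omega>. (S \<omega>)\<^sup>2)" and "t = expectation (\<lambda>\<omega>. (T \<omega>)\<^sup>2)"
  define c where "c k = fact (2 * k) / (2 ^ k * fact k :: real)" for k
  define E where "E k = expectation (\<lambda>\<omega>. S \<omega> ^ k) * expectation (\<lambda>\<omega>. T \<omega> ^ (2 * m - k))" for k
  have pow: "has_bochner_integral M (\<lambda>\<omega>. S \<omega> ^ k * T \<omega> ^ (2 * m - k)) (E k)" for k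
  proof -
    have "indep_var borel (\<lambda>\<omega>. S \<omega> ^ k) borel (\<lambda>\<omega>. T \<omega> ^ (2 * m - k))"
      using indep_var_compose[OF indep, of "\<lambda>x. x ^ k" borel "\<lambda>x. x ^ (2 * m - k)" borel]
      by (simp add: comp_def)
    from indep_var_integrable[OF this] indep_var_lebesgue_integral[OF this] show ?thesis
      using integrable_gaussian_power[OF S] integrable_gaussian_power[OF T]
      by (simp add: E_def has_bochner_integral_iff)
  qed
  have "has_bochner_integral M
      (\<lambda>\<omega>. \<Sum>k\<le>2 * m. of_nat (2 * m choose k) * \<i> ^ (2 * m - k) * complex_of_real (S \<omega> ^ k * T \<omega> ^ (2 * m - k)))
      (\<Sum>k\<le>2 * m. of_nat (2 * m choose k) * \<i> ^ (2 * m - k) * complex_of_real (E k))"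
    by (intro has_bochner_integral_sum has_bochner_integral_mult_right has_bochner_integral_of_real pow)
  \<comment> \<open>Terms with odd \<open>k\<close> vanish through the odd moments of
    \<open>S\<close>.\<close>
  also have "(\<Sum>k\<le>2 * m. of_nat (2 * m choose k) * \<i> ^ (2 * m - k) * complex_of_real (E k)) =
      (\<Sum>k\<le>m. of_nat (2 * m choose (2 * k)) * \<i> ^ (2 * m - 2 * k) * complex_of_real (E (2 * k)))"
    by (intro sum_atMost_double) (simp add: E_def expectation_gaussian_power_odd[OF S])
  also have "\<dots> = (\<Sum>k\<le>m. complex_of_real (c m * (of_nat (m choose k) * s ^ k * (- t) ^ (m - k))))"
  proof (rule sum.cong)
    fix k assume "k \<in> {..m}"
    then have k: "k \<le> m" by simp
    have E: "E (2 * k) = (c k * s ^ k) * (c (m - k) * t ^ (m - k))"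
      unfolding E_def c_def s_def t_def diff_mult_distrib2[symmetric]
        expectation_gaussian_power_even[OF S] expectation_gaussian_power_even[OF T] ..
    have "real (2 * m choose (2 * k)) = fact (2 * m) / (fact (2 * k) * fact (2 * (m - k)))"
      using k by (simp add: binomial_fact diff_mult_distrib2)
    moreover have "(2::real) ^ m = 2 ^ k * 2 ^ (m - k)"
      using k by (simp flip: power_add)
    \<comment> \<open>This identity of coefficients turns the binomial expansion of order
      \<open>2 * m\<close> into one of order \<open>m\<close>.\<close>
    ultimately have choose: "real (2 * m choose (2 * k)) * (c k * c (m - k)) = c m * real (m choose k)"
      using k by (simp add: c_def binomial_fact)
    have "real (2 * m choose (2 * k)) * (- 1) ^ (m - k) * E (2 * k) =
        (real (2 * m choose (2 * k)) * (c k * c (m - k))) * s ^ k * ((- 1) ^ (m - k) * t ^ (m - k))"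
      unfolding E by (simp add: mult_ac)
    also have "\<dots> = c m * (of_nat (m choose k) * s ^ k * (- t) ^ (m - k))"
      unfolding choose power_minus[of t] by (simp add: mult_ac)
    finally have "c m * (of_nat (m choose k) * s ^ k * (- t) ^ (m - k)) =
      real (2 * m choose (2 * k)) * (- 1) ^ (m - k) * E (2 * k)" ..
    moreover have "\<i> ^ (2 * m - 2 * k) = complex_of_real ((- 1) ^ (m - k))"
      by (simp add: diff_mult_distrib2[symmetric] power_mult)
    ultimately show "of_nat (2 * m choose (2 * k)) * \<i> ^ (2 * m - 2 * k) * complex_of_real (E (2 * k)) =
        complex_of_real (c m * (of_nat (m choose k) * s ^ k * (- t) ^ (m - k)))"
      by (simp only: of_real_mult of_real_of_nat_eq)
  qed simp
  also have "\<dots> = complex_of_real (c m * (s - t) ^ m)"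
    using binomial_ring[of s "- t" m]
    by (simp only: of_real_sum[symmetric] sum_distrib_left[symmetric] diff_conv_add_uminus)
  also have "(\<lambda>\<omega>. \<Sum>k\<le>2 * m. of_nat (2 * m choose k) * \<i> ^ (2 * m - k) * complex_of_real (S \<omega> ^ k * T \<omega> ^ (2 * m - k))) =
      (\<lambda>\<omega>. (complex_of_real (S \<omega>) + \<i> * complex_of_real (T \<omega>)) ^ (2 * m))"
    by (simp add: binomial_ring power_mult_distrib mult_ac)
  finally show ?thesis
    by (simp add: c_def s_def t_def)
qed

lemma gaussian_field_linear_combination:
  assumes X: "gaussian_field M X" and centred: "\<And>t. expectation (X t) = 0" and F: "finite F"
  shows gaussian_rv_linear_combination: "gaussian_rv M (\<lambda>\<omega>. \<Sum>t\<in>F. a t * X t \<omega>)"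
    and expectation_linear_combination: "expectation (\<lambda>\<omega>. \<Sum>t\<in>F. a t * X t \<omega>) = 0"
    and expectation_linear_combination_square: "expectation (\<lambda>\<omega>. (\<Sum>t\<in>F. a t * X t \<omega>)\<^sup>2) =
      (\<Sum>s\<in>F. \<Sum>t\<in>F. a s * a t * expectation (\<lambda>\<omega>. X s \<omega> * X t \<omega>))"
proof -
  have rv: "gaussian_rv M (\<lambda>\<omega>. \<Sum>t\<in>F. a t * X t \<omega>)" if "finite F" for F a
    using X that by (simp add: gaussian_field_def)
  show "gaussian_rv M (\<lambda>\<omega>. \<Sum>t\<in>F. a t * X t \<omega>)"
    using F by (rule rv)
  \<comment> \<open>Each single value is a linear combination over a one-point set.\<close>
  have "gaussian_rv M (X t)" for t
    using rv[of "{t}" "\<lambda>_. 1"] by simp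
  note power = integrable_gaussian_power[OF this centred]
  have int: "integrable M (X t)" for t
    using power[of t 1] by simp
  have meas [measurable]: "X t \<in> borel_measurable M" for t
    using int by (rule borel_measurable_integrable)
  have prod: "integrable M (\<lambda>\<omega>. X s \<omega> * X t \<omega>)" for s t
  proof (rule Bochner_Integration.integrable_bound)
    show "integrable M (\<lambda>\<omega>. (X s \<omega>)\<^sup>2 + (X t \<omega>)\<^sup>2)"
      by (intro Bochner_Integration.integrable_add power)
    have "\<bar>x * y\<bar> \<le> x\<^sup>2 + y\<^sup>2" for x y :: real
      using sum_squares_bound[of "\<bar>x\<bar>" "\<bar>y\<bar>"] abs_ge_zero[of "x * y"]
      unfolding abs_mult power2_abs by linarith
    then show "AE \<omega> in M. norm (X s \<omega> * X t \<omega>) \<le> norm ((X s \<omega>)\<^sup>2 + (X t \<omega>)\<^sup>2)"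
      by simp
  qed simp
  show "expectation (\<lambda>\<omega>. \<Sum>t\<in>F. a t * X t \<omega>) = 0"
    using int by (simp add: centred)
  have "(\<lambda>\<omega>. (\<Sum>t\<in>F. a t * X t \<omega>)\<^sup>2) = (\<lambda>\<omega>. \<Sum>s\<in>F. \<Sum>t\<in>F. a s * a t * (X s \<omega> * X t \<omega>))"
    by (simp add: power2_eq_square sum_product mult_ac)
  then show "expectation (\<lambda>\<omega>. (\<Sum>t\<in>F. a t * X t \<omega>)\<^sup>2) =
      (\<Sum>s\<in>F. \<Sum>t\<in>F. a s * a t * expectation (\<lambda>\<omega>. X s \<omega> * X t \<omega>))"
    using prod by simp
qed

text \<open>This is Wick's formula for the complex field \<open>Z = X + \<i> Y\<close>:
  \<open>E[Z s * Z t]\<close> vanishes, while the expectation of \<open>Z s\<close> times the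
  conjugate of \<open>Z t\<close> is \<open>2 * K s t\<close>. Only pairings of a value with a
  conjugate survive, and they form the permanent of \<open>2 * K\<close>.\<close>

lemma expectation_prod_sum_squares:
  fixes X Y :: "'t \<Rightarrow> 'a \<Rightarrow> real"
  assumes X: "gaussian_field M X" "\<And>t. expectation (X t) = 0"
      "\<And>s t. expectation (\<lambda>\<omega>. X s \<omega> * X t \<omega>) = K s t"
    and Y: "gaussian_field M Y" "\<And>t. expectation (Y t) = 0"
      "\<And>s t. expectation (\<lambda>\<omega>. Y s \<omega> * Y t \<omega>) = K s t"
    and indep: "independent_fields M X Y"
    and I: "finite I"
  shows "expectation (\<lambda>\<omega>. \<Prod>t\<in>I. (X t \<omega>)\<^sup>2 + (Y t \<omega>)\<^sup>2) = 2 ^ card I * permanent I K"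
proof -
  define m where "m = card I"
  \<comment> \<open>\<open>Inl\<close> indexes the values of \<open>Z\<close> and \<open>Inr\<close>
    their conjugates, so the product of interest is the product of \<open>z \<omega>\<close> over
    \<open>I <+> I\<close>.\<close>
  define z where "z \<omega> = case_sum (\<lambda>t. Complex (X t \<omega>) (Y t \<omega>)) (\<lambda>t. Complex (X t \<omega>) (- Y t \<omega>))" for \<omega>
  define \<epsilon> :: "'t set \<Rightarrow> real" where "\<epsilon> A = (- 1) ^ (m - card A)" for A
  define c :: real where "c = fact (2 * m) / (2 ^ m * fact m)"
  have K_sym: "K s t = K t s" for s t
    using X(3)[of s t] X(3)[of t s] by (simp add: mult.commute)
  have power: "has_bochner_integral M (\<lambda>\<omega>. (\<Sum>j\<in>A <+> B. z \<omega> j) ^ (2 * m))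
      (complex_of_real (c * (4 * (\<Sum>s\<in>A. \<Sum>t\<in>B. K s t)) ^ m))"
    if AB: "A \<subseteq> I" "B \<subseteq> I" for A B
  proof -
    define a where "a t = (of_bool (t \<in> A) :: real)" for t
    define b where "b t = (of_bool (t \<in> B) :: real)" for t
    \<comment> \<open>Conjugation keeps the real part and negates the imaginary part, hence
      \<open>a + b\<close> for \<open>X\<close> and \<open>a - b\<close> for
      \<open>Y\<close>.\<close>
    define S where "S = (\<lambda>\<omega>. \<Sum>t\<in>I. (a t + b t) * X t \<omega>)"
    define T where "T = (\<lambda>\<omega>. \<Sum>t\<in>I. (a t - b t) * Y t \<omega>)"
    have "indep_var borel ((\<lambda>f. \<Sum>t\<in>I. (a t + b t) * f t) \<circ> (\<lambda>\<omega> t. X t \<omega>))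
        borel ((\<lambda>f. \<Sum>t\<in>I. (a t - b t) * f t) \<circ> (\<lambda>\<omega> t. Y t \<omega>))"
      using indep unfolding independent_fields_def by (rule indep_var_compose) measurable
    then have ST: "indep_var borel S borel T"
      by (simp add: S_def T_def comp_def)
    have sum_A: "(\<Sum>t\<in>I. of_bool (t \<in> A) * f t) = sum f A"
      and sum_B: "(\<Sum>t\<in>I. of_bool (t \<in> B) * f t) = sum f B" for f :: "'t \<Rightarrow> real"
      using AB I by (simp_all add: of_bool_def if_distribR if_distrib[of "\<lambda>u. u * _"]
          sum.inter_restrict[symmetric] Int_absorb1 cong: if_cong)
    have fin: "finite A" "finite B"
      using AB I by (auto intro: finite_subset)
    have "S \<omega> = (\<Sum>t\<in>A. X t \<omega>) + (\<Sum>t\<in>B. X t \<omega>)" for \<omega>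
      by (simp add: S_def a_def b_def distrib_right sum.distrib sum_A sum_B)
    moreover have "T \<omega> = (\<Sum>t\<in>A. Y t \<omega>) - (\<Sum>t\<in>B. Y t \<omega>)" for \<omega>
      by (simp add: T_def a_def b_def left_diff_distrib sum_subtractf sum_A sum_B)
    ultimately have z: "(\<Sum>j\<in>A <+> B. z \<omega> j) = complex_of_real (S \<omega>) + \<i> * complex_of_real (T \<omega>)" for \<omega>
      using fin by (simp add: sum.Plus z_def complex_eq_iff sum_negf)
    have "expectation (\<lambda>\<omega>. (S \<omega>)\<^sup>2) - expectation (\<lambda>\<omega>. (T \<omega>)\<^sup>2) =
        (\<Sum>s\<in>I. \<Sum>t\<in>I. (a s + b s) * (a t + b t) * K s t - (a s - b s) * (a t - b t) * K s t)"
      by (simp add: S_def T_def expectation_linear_combination_square[OF X(1,2) I]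
          expectation_linear_combination_square[OF Y(1,2) I] X(3) Y(3) sum_subtractf)
    \<comment> \<open>The products \<open>a s * a t\<close> and \<open>b s * b t\<close> cancel and
      only mixed ones remain; symmetry of \<open>K\<close> then makes the two double sums
      equal.\<close>
    also have "\<dots> = 2 * (\<Sum>s\<in>I. \<Sum>t\<in>I. a s * (b t * K s t)) + 2 * (\<Sum>s\<in>I. \<Sum>t\<in>I. a t * (b s * K s t))"
      by (simp add: sum_distrib_left sum.distrib[symmetric] algebra_simps)
    also have "(\<Sum>s\<in>I. \<Sum>t\<in>I. a t * (b s * K s t)) = (\<Sum>s\<in>I. \<Sum>t\<in>I. a s * (b t * K s t))"
      by (subst sum.swap) (simp add: K_sym)
    also have "(\<Sum>s\<in>I. \<Sum>t\<in>I. a s * (b t * K s t)) = (\<Sum>s\<in>A. \<Sum>t\<in>B. K s t)"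
      by (simp add: a_def b_def sum_A sum_B sum_distrib_left[symmetric])
    finally have "expectation (\<lambda>\<omega>. (S \<omega>)\<^sup>2) - expectation (\<lambda>\<omega>. (T \<omega>)\<^sup>2) = 4 * (\<Sum>s\<in>A. \<Sum>t\<in>B. K s t)"
      by simp
    then show ?thesis
      using expectation_complex_gaussian_power[OF _ _ _ _ ST, of m]
        gaussian_rv_linear_combination[OF X(1,2) I, of "\<lambda>t. a t + b t"]
        expectation_linear_combination[OF X(1,2) I, of "\<lambda>t. a t + b t"]
        gaussian_rv_linear_combination[OF Y(1,2) I, of "\<lambda>t. a t - b t"]
        expectation_linear_combination[OF Y(1,2) I, of "\<lambda>t. a t - b t"]
      by (simp add: z c_def S_def T_def)
  qed
  have split: "fact (2 * m) * complex_of_real (\<Prod>t\<in>I. (X t \<omega>)\<^sup>2 + (Y t \<omega>)\<^sup>2) =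
      (\<Sum>(A, B)\<in>Pow I \<times> Pow I. complex_of_real (\<epsilon> A * \<epsilon> B) * (\<Sum>j\<in>A <+> B. z \<omega> j) ^ (2 * m))" for \<omega>
  proof -
    have card: "card (I <+> I) = 2 * m"
      using I by (simp add: card_Plus m_def)
    have "prod (z \<omega>) (I <+> I) = (\<Prod>t\<in>I. Complex (X t \<omega>) (Y t \<omega>) * Complex (X t \<omega>) (- Y t \<omega>))"
      using I by (simp add: prod.Plus prod.distrib z_def)
    also have "\<dots> = complex_of_real (\<Prod>t\<in>I. (X t \<omega>)\<^sup>2 + (Y t \<omega>)\<^sup>2)"
      unfolding of_real_prod by (intro prod.cong) (simp_all add: complex_eq_iff power2_eq_square)
    finally have "fact (2 * m) * complex_of_real (\<Prod>t\<in>I. (X t \<omega>)\<^sup>2 + (Y t \<omega>)\<^sup>2) =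
        (\<Sum>C\<in>Pow (I <+> I). (- 1) ^ (2 * m - card C) * (\<Sum>j\<in>C. z \<omega> j) ^ (2 * m))"
      using polarization[of "I <+> I" "z \<omega>"] I by (simp add: card)
    also have "\<dots> = (\<Sum>(A, B)\<in>Pow I \<times> Pow I. complex_of_real (\<epsilon> A * \<epsilon> B) * (\<Sum>j\<in>A <+> B. z \<omega> j) ^ (2 * m))"
    \<comment> \<open>Every subset of \<open>I <+> I\<close> is \<open>A <+> B\<close> for a unique
      pair of subsets of \<open>I\<close>.\<close>
    proof (rule sum.reindex_bij_witness[where i = "\<lambda>(A, B). A <+> B" and j = "\<lambda>C. (Inl -` C, Inr -` C)"])
      fix C assume C: "C \<in> Pow (I <+> I)"
      define A B where "A = Inl -` C" and "B = Inr -` C"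
      have AB: "A \<subseteq> I" "B \<subseteq> I"
        using C by (auto simp: A_def B_def)
      have C_eq: "A <+> B = C"
        by (auto simp: A_def B_def Plus_def image_iff) (metis sum.exhaust)
      then show "(case (Inl -` C, Inr -` C) of (A, B) \<Rightarrow> A <+> B) = C"
        by (simp add: A_def B_def)
      show "(Inl -` C, Inr -` C) \<in> Pow I \<times> Pow I"
        using AB by (simp add: A_def B_def)
      have "card A \<le> m" "card B \<le> m" and fin: "finite A" "finite B"
        using AB I by (auto simp: m_def intro: card_mono finite_subset)
      \<comment> \<open>Splitting the truncated subtraction needs both cardinalities to be at most
        \<open>m\<close>.\<close>
      then have "2 * m - card C = (m - card A) + (m - card B)"
        by (simp add: C_eq[symmetric] card_Plus)
      then show "(case (Inl -` C, Inr -` C) of (A, B) \<Rightarrow>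
          complex_of_real (\<epsilon> A * \<epsilon> B) * (\<Sum>j\<in>A <+> B. z \<omega> j) ^ (2 * m)) =
          (- 1) ^ (2 * m - card C) * (\<Sum>j\<in>C. z \<omega> j) ^ (2 * m)"
        using C_eq by (simp add: A_def B_def \<epsilon>_def power_add)
    qed auto
    finally show ?thesis .
  qed
  have "has_bochner_integral M
      (\<lambda>\<omega>. \<Sum>(A, B)\<in>Pow I \<times> Pow I. complex_of_real (\<epsilon> A * \<epsilon> B) * (\<Sum>j\<in>A <+> B. z \<omega> j) ^ (2 * m))
      (\<Sum>(A, B)\<in>Pow I \<times> Pow I. complex_of_real (\<epsilon> A * \<epsilon> B) *
        complex_of_real (c * (4 * (\<Sum>s\<in>A. \<Sum>t\<in>B. K s t)) ^ m))"
    unfolding case_prod_beta by (intro has_bochner_integral_sum has_bochner_integral_mult_right power) auto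
  then have "has_bochner_integral M
      (\<lambda>\<omega>. complex_of_real (fact (2 * m) * (\<Prod>t\<in>I. (X t \<omega>)\<^sup>2 + (Y t \<omega>)\<^sup>2)))
      (complex_of_real (\<Sum>(A, B)\<in>Pow I \<times> Pow I. \<epsilon> A * \<epsilon> B * (c * (4 * (\<Sum>s\<in>A. \<Sum>t\<in>B. K s t)) ^ m)))"
    unfolding split[symmetric] by (simp add: case_prod_beta)
  from has_bochner_integral_integral_eq[OF this]
  have "fact (2 * m) * expectation (\<lambda>\<omega>. \<Prod>t\<in>I. (X t \<omega>)\<^sup>2 + (Y t \<omega>)\<^sup>2) =
      (\<Sum>(A, B)\<in>Pow I \<times> Pow I. \<epsilon> A * \<epsilon> B * (c * (4 * (\<Sum>s\<in>A. \<Sum>t\<in>B. K s t)) ^ m))"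
    unfolding integral_complex_of_real of_real_eq_iff by simp
  also have "\<dots> = c * 4 ^ m * (\<Sum>A\<in>Pow I. \<Sum>B\<in>Pow I. \<epsilon> B * (\<epsilon> A * (\<Sum>s\<in>A. \<Sum>t\<in>B. K s t) ^ m))"
    unfolding sum.cartesian_product[symmetric] power_mult_distrib sum_distrib_left[of "c * 4 ^ m"]
    by (simp add: mult_ac)
  \<comment> \<open>For fixed \<open>B\<close>, the sum over \<open>A\<close> is the polarization,
    read backwards, of the row sums of \<open>K\<close> over \<open>B\<close>.\<close>
  also have "(\<Sum>A\<in>Pow I. \<Sum>B\<in>Pow I. \<epsilon> B * (\<epsilon> A * (\<Sum>s\<in>A. \<Sum>t\<in>B. K s t) ^ m)) =
      (\<Sum>B\<in>Pow I. \<epsilon> B * (fact m * (\<Prod>s\<in>I. \<Sum>t\<in>B. K s t)))"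
    unfolding m_def \<epsilon>_def polarization[OF I]
    by (subst sum.swap) (simp add: sum_distrib_left)
  \<comment> \<open>The remaining signed sum over \<open>B\<close> is Ryser's formula.\<close>
  also have "\<dots> = fact m * permanent I K"
    unfolding permanent_def ryser_formula[OF I]
    by (simp add: \<epsilon>_def m_def sum_distrib_left mult_ac)
  also have "c * 4 ^ m * (fact m * permanent I K) = fact (2 * m) * (2 ^ m * permanent I K)"
  proof -
    have "(4::real) ^ m = 2 ^ m * 2 ^ m"
      by (simp flip: power_mult_distrib)
    then show ?thesis
      by (simp add: c_def)
  qed
  finally show ?thesis
    by (simp add: m_def)
qed

end

section \<open>The box and its rescaled copy\<close>

text \<open>Finiteness and cardinality of the box thereby reduce to those of a function
  space.\<close>

lemma box_lattice_eq_image: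
  "(box_lattice N :: (real^'d::finite) set) = vec_lambda ` (UNIV \<rightarrow>\<^sub>E real ` {1..N})"
proof (intro equalityI subsetI)
  fix x :: "real^'d" assume "x \<in> box_lattice N"
  then have "vec_nth x \<in> UNIV \<rightarrow>\<^sub>E real ` {1..N}"
    by (auto simp: box_lattice_def PiE_iff)
  then show "x \<in> vec_lambda ` (UNIV \<rightarrow>\<^sub>E real ` {1..N})"
    by (rule rev_image_eqI) simp
qed (fastforce simp: box_lattice_def PiE_iff)

lemma finite_box_lattice: "finite (box_lattice N :: (real^'d::finite) set)"
  unfolding box_lattice_eq_image by (intro finite_imageI finite_PiE) auto

lemma card_box_lattice: "card (box_lattice N :: (real^'d::finite) set) = N ^ CARD('d)"
proof -
  have "inj_on vec_lambda (UNIV \<rightarrow>\<^sub>E real ` {1..N} :: ('d \<Rightarrow> real) set)"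
    by (auto simp: inj_on_def vec_lambda_inject)
  then show ?thesis
    unfolding box_lattice_eq_image by (simp add: card_image card_PiE inj_on_def)
qed

lemma finite_box_perms: "finite (box_perms N :: (real^'d::finite \<Rightarrow> real^'d) set)"
  unfolding box_perms_def by (intro finite_permutations finite_box_lattice)

text \<open>Subtracting the all-ones vector moves coordinates from \<open>{1..N}\<close> to
  \<open>{0..<N}\<close>; scaling is injective as \<open>\<beta>\<close> is nonzero.\<close>

lemma bij_betw_box_scaled_lattice:
  assumes "\<beta> > 0"
  shows "bij_betw (\<lambda>x. \<beta> *\<^sub>R (x - 1)) (box_lattice N :: (real^'d::finite) set) (scaled_lattice N \<beta>)"
proof -
  have "(\<lambda>x. x - 1) ` (box_lattice N :: (real^'d) set) = {x. \<forall>i. \<exists>k\<in>{0..<N}. x $ i = real k}"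
  proof (intro equalityI subsetI)
    fix y :: "real^'d" assume "y \<in> (\<lambda>x. x - 1) ` box_lattice N"
    then obtain x :: "real^'d" where x: "y = x - 1" "x \<in> box_lattice N"
      by blast
    have "\<exists>k\<in>{0..<N}. y $ i = real k" for i
    proof -
      obtain k where "k \<in> {1..N}" "x $ i = real k"
        using x unfolding box_lattice_def by blast
      then show ?thesis
        using x by (intro bexI[of _ "k - 1"]) auto
    qed
    then show "y \<in> {x. \<forall>i. \<exists>k\<in>{0..<N}. x $ i = real k}"
      by simp
  next
    fix x :: "real^'d" assume x: "x \<in> {x. \<forall>i. \<exists>k\<in>{0..<N}. x $ i = real k}"
    have "\<exists>k\<in>{1..N}. (x + 1) $ i = real k" for i
    proof -
      obtain k where "k \<in> {0..<N}" "x $ i = real k"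
        using x by blast
      then show ?thesis
        by (intro bexI[of _ "Suc k"]) auto
    qed
    then have "x + 1 \<in> box_lattice N"
      by (simp add: box_lattice_def)
    then show "x \<in> (\<lambda>x. x - 1) ` box_lattice N"
      by (rule rev_image_eqI) simp
  qed
  then have "(\<lambda>x. \<beta> *\<^sub>R (x - 1)) ` (box_lattice N :: (real^'d) set) = scaled_lattice N \<beta>"
    unfolding scaled_lattice_def by (metis image_image)
  then show ?thesis
    using assms by (auto simp: bij_betw_def inj_on_def)
qed

section \<open>The partition function and its logarithmic derivative\<close>

lemma partition_function_eq_permanent:
  "partition_function TYPE('d::finite) N \<beta> = permanent (box_lattice N :: (real^'d) set) (distance_matrix \<beta>)"
  by (simp add: partition_function_def permanent_def box_perms_def hamiltonian_def distance_matrix_def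
      exp_sum[OF finite_box_lattice] sum_distrib_left flip: sum_negf)

lemma partition_function_pos: "partition_function TYPE('d::finite) N \<beta> > 0"
  unfolding partition_function_def
  by (rule sum_pos[OF finite_box_perms]) (auto simp: box_perms_def intro: permutes_id)

text \<open>The shift cancels in differences and the norm is homogeneous, so the covariance matrix
  of the field on the scaled lattice is the distance matrix on the box.\<close>

lemma permanent_eq_field_moment:
  fixes X Y :: "real^'d::finite \<Rightarrow> 'w \<Rightarrow> real"
  assumes "\<beta> > 0" and "exp_gaussian_field M X" and "exp_gaussian_field M Y"
    and "independent_fields M X Y"
  shows "permanent (box_lattice N :: (real^'d) set) (distance_matrix \<beta>) =
    1 / 2 ^ (N ^ CARD('d)) * field_moment M X Y N \<beta>"
proof -
  interpret prob_space M
    using assms(2) by (simp add: exp_gaussian_field_def gaussian_field_def)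
  note bij = bij_betw_box_scaled_lattice[OF \<open>\<beta> > 0\<close>, of N, where ?'d = 'd]
  have "finite (scaled_lattice N \<beta> :: (real^'d) set)"
    using bij_betw_finite[OF bij] finite_box_lattice by blast
  then have "field_moment M X Y N \<beta> =
      2 ^ card (scaled_lattice N \<beta> :: (real^'d) set) *
      permanent (scaled_lattice N \<beta>) (\<lambda>s t :: real^'d. exp (- norm (s - t)))"
    unfolding field_moment_def
    using assms(2-4) by (intro expectation_prod_sum_squares) (auto simp: exp_gaussian_field_def)
  also have "card (scaled_lattice N \<beta> :: (real^'d) set) = N ^ CARD('d)"
    using bij_betw_same_card[OF bij] by (simp add: card_box_lattice)
  also have "permanent (scaled_lattice N \<beta>) (\<lambda>s t :: real^'d. exp (- norm (s - t))) =
      permanent (box_lattice N :: (real^'d) set) (distance_matrix \<beta>)"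
  proof (rule permanent_reindex[OF bij])
    fix x y :: "real^'d"
    have "\<beta> *\<^sub>R (x - 1) - \<beta> *\<^sub>R (y - 1) = \<beta> *\<^sub>R (x - y)"
      by (simp add: algebra_simps)
    then show "exp (- norm (\<beta> *\<^sub>R (x - 1) - \<beta> *\<^sub>R (y - 1))) = distance_matrix \<beta> x y"
      using \<open>\<beta> > 0\<close> by (simp only: norm_scaleR distance_matrix_def) simp
  qed
  finally show ?thesis
    by simp
qed

text \<open>Each Boltzmann weight contributes a factor \<open>- hamiltonian N p\<close> to the
  derivative; division by the partition function turns the sum into minus the Gibbs
  expectation.\<close>

lemma has_derivative_ln_partition_function:
  "((\<lambda>b. 1 / real (N ^ CARD('d::finite)) * ln (partition_function TYPE('d) N b))
    has_real_derivative - mean_displacement TYPE('d) N \<beta>) (at \<beta>)"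
proof -
  let ?P = "box_perms N :: (real^'d \<Rightarrow> real^'d) set"
  let ?Z = "partition_function TYPE('d) N"
  have "(?Z has_real_derivative (\<Sum>p\<in>?P. exp (- \<beta> * hamiltonian N p) * - hamiltonian N p)) (at \<beta>)"
    unfolding partition_function_def by (auto intro!: derivative_eq_intros sum.cong)
  then have "((\<lambda>b. 1 / real (N ^ CARD('d)) * ln (?Z b)) has_real_derivative
      1 / real (N ^ CARD('d)) * (1 / ?Z \<beta> * (\<Sum>p\<in>?P. exp (- \<beta> * hamiltonian N p) * - hamiltonian N p))) (at \<beta>)"
    by (intro DERIV_cmult DERIV_chain2[OF DERIV_ln_divide] partition_function_pos)
  also have "1 / ?Z \<beta> * (\<Sum>p\<in>?P. exp (- \<beta> * hamiltonian N p) * - hamiltonian N p) =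
      - integral\<^sup>L (gibbs_measure N \<beta>) (hamiltonian N :: (real^'d \<Rightarrow> real^'d) \<Rightarrow> real)"
    unfolding gibbs_measure_def
    by (subst lebesgue_integral_point_measure_finite[OF finite_box_perms])
      (auto simp: sum_distrib_left sum_negf partition_function_pos less_imp_le intro!: sum.cong)
  finally show ?thesis
    by (simp add: mean_displacement_def)
qed

theorem proposition1p9:
  fixes M :: "'w measure"
    and X Y :: "real^'d::finite \<Rightarrow> 'w \<Rightarrow> real"
    and N :: nat and \<beta> :: real
  assumes "N \<ge> 1" and "\<beta> > 0"
    and "prob_space M"
    and "exp_gaussian_field M X" and "exp_gaussian_field M Y"
    and "independent_fields M X Y"
  shows "partition_function TYPE('d) N \<beta> =
           permanent (box_lattice N :: (real^'d) set) (distance_matrix \<beta>) \<and>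
         permanent (box_lattice N :: (real^'d) set) (distance_matrix \<beta>) =
           1 / 2 ^ (N ^ CARD('d)) * field_moment M X Y N \<beta> \<and>
         ((\<lambda>b. 1 / real (N ^ CARD('d)) * ln (partition_function TYPE('d) N b))
           has_real_derivative - mean_displacement TYPE('d) N \<beta>) (at \<beta>) \<and>
         ((\<lambda>b. 1 / real (N ^ CARD('d)) * ln (field_moment M X Y N b))
           has_real_derivative - mean_displacement TYPE('d) N \<beta>) (at \<beta>)"
proof (intro conjI)
  \<comment> \<open>The identity is needed for all \<open>b > 0\<close>, since a derivative at
    \<open>\<beta>\<close> depends on a neighbourhood.\<close>
  have Z_eq: "partition_function TYPE('d) N b = 1 / 2 ^ (N ^ CARD('d)) * field_moment M X Y N b" if "b > 0" for b
    using permanent_eq_field_moment[OF that assms(4-6)] by (simp add: partition_function_eq_permanent)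
  show "partition_function TYPE('d) N \<beta> =
      permanent (box_lattice N :: (real^'d) set) (distance_matrix \<beta>)"
    by (rule partition_function_eq_permanent)
  show "permanent (box_lattice N :: (real^'d) set) (distance_matrix \<beta>) =
      1 / 2 ^ (N ^ CARD('d)) * field_moment M X Y N \<beta>"
    using assms by (intro permanent_eq_field_moment)
  show D: "((\<lambda>b. 1 / real (N ^ CARD('d)) * ln (partition_function TYPE('d) N b))
      has_real_derivative - mean_displacement TYPE('d) N \<beta>) (at \<beta>)"
    by (rule has_derivative_ln_partition_function)
  \<comment> \<open>The power of 2 becomes an additive constant under the logarithm.\<close>
  have "((\<lambda>b. 1 / real (N ^ CARD('d)) * ln (2 ^ (N ^ CARD('d))) +
        1 / real (N ^ CARD('d)) * ln (partition_function TYPE('d) N b))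
      has_real_derivative - mean_displacement TYPE('d) N \<beta>) (at \<beta>)"
    using DERIV_add[OF DERIV_const D] by simp
  then show "((\<lambda>b. 1 / real (N ^ CARD('d)) * ln (field_moment M X Y N b))
      has_real_derivative - mean_displacement TYPE('d) N \<beta>) (at \<beta>)"
  \<comment> \<open>Agreement is established on the open half-line \<open>{0<..}\<close>, which
    contains \<open>\<beta>\<close>.\<close>
  proof (rule has_field_derivative_transform_within_open)
    fix b :: real assume "b \<in> {0<..}"
    then have "field_moment M X Y N b = 2 ^ (N ^ CARD('d)) * partition_function TYPE('d) N b"
      using Z_eq[of b] by simp
    then show "1 / real (N ^ CARD('d)) * ln (2 ^ (N ^ CARD('d))) +
        1 / real (N ^ CARD('d)) * ln (partition_function TYPE('d) N b) =
        1 / real (N ^ CARD('d)) * ln (field_moment M X Y N b)"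
      using partition_function_pos[of N b, where ?'d = 'd]
      by (simp only: ln_mult_pos zero_less_power zero_less_numeral distrib_left)
  qed (use \<open>\<beta> > 0\<close> in auto)
qed

end
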